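(* (a) Let $\langle x_n\rangle_{n=1}^\infty$ be a minimal sequence and $A$ a $\mathrm{central}^*$ set in $(\mathbb{Z}[i],+)$. Then there exists a sum subsystem $\langle y_n\rangle_{n=1}^\infty$ of $\langle x_n\rangle_{n=1}^\infty$ such that $FS(\langle y_n\rangle_{n=1}^\infty)\cup FP(\langle y_n\rangle_{n=1}^\infty)\subseteq A$. (b) Let $\langle x_n\rangle_{n=1}^\infty$ be an almost minimal sequence and $A$ a $C^*$-set in $(\mathbb{Z}[i],+)$. Then there exists a sum subsystem $\langle y_n\rangle_{n=1}^\infty$ of $\langle x_n\rangle_{n=1}^\infty$ such that $FS(\langle y_n\rangle_{n=1}^\infty)\cup FP(\langle y_n\rangle_{n=1}^\infty)\subseteq A$.
   Context: $\mathbb{Z}[i]$ is the ring of Gaussian integers. For a sequence $\langle y_n\rangle$ and $m\in\mathbb{N}$, $FS(\langle y_n\rangle_{n=m}^\infty)=\{\sum_{n\in F}y_n\}$ and $FP(\langle y_n\rangle_{n=m}^\infty)=\{\prod_{n\in F}y_n\}$, $F$ ranging over finite nonempty subsets of $\{m,m+1,\dots\}$. A sequence $\langle y_n\rangle$ is a sum subsystem of $\langle x_n\rangle$ if there are finite nonempty $H_n\subseteq\mathbb{N}$ with $\max H_n<\min H_{n+1}$ and $y_n=\sum_{t\in H_n}x_t$ for all $n$. $\beta\mathbb{Z}[i]$ is the set of ultrafilters on $\mathbb{Z}[i]$ with $A\in p+q$ iff $\{x:-x+A\in q\}\in p$ ($-x+A=\{y:x+y\in A\}$), a compact right topological semigroup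 with smallest ideal $K(\beta\mathbb{Z}[i])$; $\overline{B}=\{p: B\in p\}$. A set is $\mathrm{central}^*$ if it belongs to every idempotent in $K(\beta\mathbb{Z}[i])$. A $J$-set is a set $A$ such that for every finite nonempty set $F$ of sequences $\mathbb{N}\to\mathbb{Z}[i]$ there exist $a\in\mathbb{Z}[i]$ and finite nonempty $H\subseteq\mathbb{N}$ with $a+\sum_{t\in H}f(t)\in A$ for all $f\in F$; $J(\mathbb{Z}[i])$ is the set of ultrafilters all of whose members are $J$-sets; a $C^*$-set is one belonging to every idempotent in $J(\mathbb{Z}[i])$. A sequence $\langle x_n\rangle$ is minimal if $\bigcap_{m=1}^\infty\overline{FS(\langle x_n\rangle_{n=m}^\infty)}\cap K(\beta\mathbb{Z}[i])\neq\emptyset$, and almost minimal if $\bigcap_{m=1}^\infty\overline{FS(\langle x_n\rangle_{n=m}^\infty)}\cap J(\mathbb{Z}[i])\neq\emptyset$. *)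

theory Defs
  imports Complex_Main
begin

section \<open>The Gaussian integers\<close>

typedef gauss_int = "{z::complex. Re z \<in> \<int> \<and> Im z \<in> \<int>}"
  by (rule exI[of _ 0]) simp

setup_lifting type_definition_gauss_int

instantiation gauss_int :: idom
begin

lift_definition zero_gauss_int :: gauss_int is 0 by simp
lift_definition one_gauss_int :: gauss_int is 1 by simp
lift_definition plus_gauss_int :: "gauss_int \<Rightarrow> gauss_int \<Rightarrow> gauss_int" is "(+)" by simp
lift_definition minus_gauss_int :: "gauss_int \<Rightarrow> gauss_int \<Rightarrow> gauss_int" is "(-)" by simp
lift_definition uminus_gauss_int :: "gauss_int \<Rightarrow> gauss_int" is uminus by simp
lift_definition times_gauss_int :: "gauss_int \<Rightarrow> gauss_int \<Rightarrow> gauss_int" is "(*)" by simp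

instance
  by standard (transfer; simp add: algebra_simps)+

end


section \<open>The semigroup of ultrafilters\<close>

text \<open>A set \<open>A\<close> belongs to the ultrafilter \<open>p\<close> iff \<open>eventually (\<lambda>x. x \<in> A) p\<close>;
  note that \<^const>\<open>bot\<close> is the improper filter.\<close>

definition ultrafilters :: "'a filter set" where
  "ultrafilters = {p. p \<noteq> bot \<and> (\<forall>P. eventually P p \<or> eventually (\<lambda>x. \<not> P x) p)}"

definition filter_add :: "'a::plus filter \<Rightarrow> 'a filter \<Rightarrow> 'a filter"  (infixl "\<oplus>" 65) where
  "p \<oplus> q = Abs_filter (\<lambda>P. eventually (\<lambda>x. eventually (\<lambda>y. P (x + y)) q) p)"

lemma eventually_filter_add:
  "eventually P (p \<oplus> q) \<longleftrightarrow> eventually (\<lambda>x. eventually (\<lambda>y. P (x + y)) q) p"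
  unfolding filter_add_def
proof (rule eventually_Abs_filter, standard, goal_cases)
  case 1
  show ?case by simp
next
  case (2 P Q)
  then show ?case
    by (auto elim: eventually_elim2 intro: eventually_conj)
next
  case (3 P Q)
  then show ?case
    by (auto elim!: eventually_mono)
qed

lemma mem_filter_add:
  "eventually (\<lambda>z. z \<in> A) (p \<oplus> q) \<longleftrightarrow>
     eventually (\<lambda>x. x \<in> {x. eventually (\<lambda>y. y \<in> {y. x + y \<in> A}) q}) p"
  by (simp add: eventually_filter_add)

lemma filter_add_in_ultrafilters:
  assumes "p \<in> ultrafilters" "q \<in> ultrafilters"
  shows "p \<oplus> q \<in> ultrafilters"
proof -
  have q: "eventually (\<lambda>y. \<not> P y) q \<longleftrightarrow> \<not> eventually P q" for P
    using assms(2) eventually_conj[of P q "\<lambda>y. \<not> P y"]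
    by (auto simp: ultrafilters_def trivial_limit_def)
  have "\<not> eventually (\<lambda>x. False) p" "\<not> eventually (\<lambda>y. False) q"
    using assms by (auto simp: ultrafilters_def trivial_limit_def)
  then show ?thesis
    using assms(1) q
    by (auto simp: ultrafilters_def trivial_limit_def eventually_filter_add)
qed

definition beta_closure :: "'a set \<Rightarrow> 'a filter set" where
  "beta_closure B = {p \<in> ultrafilters. eventually (\<lambda>x. x \<in> B) p}"

definition beta_ideal :: "'a::plus filter set \<Rightarrow> bool" where
  "beta_ideal I \<longleftrightarrow> I \<noteq> {} \<and> I \<subseteq> ultrafilters \<and>
     (\<forall>p\<in>I. \<forall>q\<in>ultrafilters. p \<oplus> q \<in> I \<and> q \<oplus> p \<in> I)"

definition smallest_ideal :: "'a::plus filter set" where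
  "smallest_ideal = \<Inter> {I. beta_ideal I}"

lemma smallest_ideal_eqI:
  assumes "beta_ideal I" and "\<And>I'. beta_ideal I' \<Longrightarrow> I \<subseteq> I'"
  shows "smallest_ideal = I"
  using assms unfolding smallest_ideal_def by blast

definition central_star :: "'a::plus set \<Rightarrow> bool" where
  "central_star A \<longleftrightarrow>
     (\<forall>p\<in>smallest_ideal. p \<oplus> p = p \<longrightarrow> eventually (\<lambda>x. x \<in> A) p)"


section \<open>\<open>J\<close>-sets and \<open>C\<^sup>*\<close>-sets\<close>

text \<open>Sequences are indexed by the positive integers: below, a sequence is a function on
  \<^typ>\<open>nat\<close> whose value at \<open>0\<close> is never used.\<close>

definition J_set :: "'a::comm_monoid_add set \<Rightarrow> bool" where
  "J_set A \<longleftrightarrow>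
     (\<forall>F :: (nat \<Rightarrow> 'a) set. finite F \<and> F \<noteq> {} \<longrightarrow>
        (\<exists>a H. finite H \<and> H \<noteq> {} \<and> H \<subseteq> {1..} \<and> (\<forall>f\<in>F. a + (\<Sum>t\<in>H. f t) \<in> A)))"

definition J_ultrafilters :: "'a::comm_monoid_add filter set" where
  "J_ultrafilters = {p \<in> ultrafilters. \<forall>A. eventually (\<lambda>x. x \<in> A) p \<longrightarrow> J_set A}"

definition C_star :: "'a::comm_monoid_add set \<Rightarrow> bool" where
  "C_star A \<longleftrightarrow>
     (\<forall>p\<in>J_ultrafilters. p \<oplus> p = p \<longrightarrow> eventually (\<lambda>x. x \<in> A) p)"


section \<open>Finite sums, finite products and minimal sequences\<close>

definition FS :: "(nat \<Rightarrow> 'a::comm_monoid_add) \<Rightarrow> nat \<Rightarrow> 'a set" where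
  "FS y m = {(\<Sum>n\<in>F. y n) | F. finite F \<and> F \<noteq> {} \<and> F \<subseteq> {m..}}"

definition FP :: "(nat \<Rightarrow> 'a::comm_monoid_mult) \<Rightarrow> nat \<Rightarrow> 'a set" where
  "FP y m = {(\<Prod>n\<in>F. y n) | F. finite F \<and> F \<noteq> {} \<and> F \<subseteq> {m..}}"

definition sum_subsystem ::
    "(nat \<Rightarrow> 'a::comm_monoid_add) \<Rightarrow> (nat \<Rightarrow> 'a) \<Rightarrow> bool" where
  "sum_subsystem y x \<longleftrightarrow>
     (\<exists>H :: nat \<Rightarrow> nat set. \<forall>n\<ge>1.
        finite (H n) \<and> H n \<noteq> {} \<and> H n \<subseteq> {1..} \<and>
        Max (H n) < Min (H (Suc n)) \<and> y n = (\<Sum>t\<in>H n. x t))"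

definition minimal_seq :: "(nat \<Rightarrow> 'a::comm_monoid_add) \<Rightarrow> bool" where
  "minimal_seq x \<longleftrightarrow> (\<Inter>m\<in>{1..}. beta_closure (FS x m)) \<inter> smallest_ideal \<noteq> {}"

definition almost_minimal_seq :: "(nat \<Rightarrow> 'a::comm_monoid_add) \<Rightarrow> bool" where
  "almost_minimal_seq x \<longleftrightarrow>
     (\<Inter>m\<in>{1..}. beta_closure (FS x m)) \<inter> J_ultrafilters \<noteq> {}"

end

theory Submission
  imports Defs "HOL-Library.FuncSet" "HOL-Library.Infinite_Set"
begin

text \<open>Both smallest-ideal ultrafilters and \<open>J\<close>-ultrafilters form a left ideal \<open>I\<close> that contains no
  principal ultrafilter at \<open>0\<close> and is closed under scaling by every \<open>a \<noteq> 0\<close>. For the smallest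
  ideal, the latter holds because the preimage of an ideal under scaling is again an ideal; it is
  nonempty as \<open>a\<close> has finitely many residues, so that every ultrafilter has a translate
  containing the multiples of \<open>a\<close>. If an ultrafilter \<open>p \<in> I\<close> contains all tails
  \<open>FS x m\<close> and \<open>T\<close> is the set of all such ultrafilters, then \<open>T \<oplus> p\<close> is a compact semigroup
  inside \<open>T \<inter> I\<close>, hence contains an idempotent \<open>e\<close>. Since \<open>a e\<close> is again an idempotent in \<open>I\<close>,
  all the sets \<open>{z. a * z \<in> A}\<close> belong to \<open>e\<close>, and the terms of the subsystem can be chosen one
  after the other in finite intersections of members of \<open>e\<close>.\<close>

section \<open>Ultrafilters and idempotents\<close>

text \<open>Zorn's lemma for the reversed order. It serves twice: with proper filters, to produce
  ultrafilters, and with closed subsemigroups, to produce idempotents.\<close>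

lemma minimal_filter_exists:
  fixes F :: "'a filter"
  assumes "P F" and chain: "\<And>C. C \<noteq> {} \<Longrightarrow> (\<And>G. G \<in> C \<Longrightarrow> P G) \<Longrightarrow>
      (\<And>G H. G \<in> C \<Longrightarrow> H \<in> C \<Longrightarrow> G \<le> H \<or> H \<le> G) \<Longrightarrow> P (Inf C)"
  obtains M where "P M" "M \<le> F" "\<And>N. P N \<Longrightarrow> N \<le> M \<Longrightarrow> N = M"
proof -
  let ?S = "{G. P G \<and> G \<le> F}"
  have "\<exists>M\<in>?S. \<forall>N\<in>?S. N \<le> M \<longrightarrow> N = M"
  proof (rule predicate_Zorn[of ?S "\<lambda>G H. H \<le> G"])
    show "partial_order_on ?S (relation_of (\<lambda>G H. H \<le> G) ?S)"
      by (auto simp: partial_order_on_def preorder_on_def refl_on_def trans_def antisym_def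
          relation_of_def)
  next
    fix C assume C: "C \<in> Chains (relation_of (\<lambda>G H. H \<le> G) ?S)"
    show "\<exists>u\<in>?S. \<forall>a\<in>C. u \<le> a"
    \<comment> \<open>\<open>Inf {}\<close> is \<open>top\<close>, which need not satisfy
      \<open>P\<close>; the empty chain is bounded by \<open>F\<close> instead.\<close>
    proof (cases "C = {}")
      case True
      then show ?thesis using assms(1) by auto
    next
      case False
      have CS: "C \<subseteq> ?S"
        using C by (auto simp: Chains_def relation_of_def)
      have "P (Inf C)"
        using False CS C by (intro chain) (auto simp: Chains_def relation_of_def)
      moreover have "Inf C \<le> F"
        using False CS by (metis (mono_tags, lifting) Inf_lower2 all_not_in_conv mem_Collect_eq subsetD)
      ultimately show ?thesis
        by (auto intro: Inf_lower)
    qed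
  qed
  then show thesis
    using that by (metis (mono_tags, lifting) mem_Collect_eq order_trans)
qed

lemma eventually_Inf_chain:
  assumes "C \<noteq> {}" "\<And>G H. G \<in> C \<Longrightarrow> H \<in> C \<Longrightarrow> G \<le> H \<or> H \<le> G"
  shows "eventually P (Inf C) \<longleftrightarrow> (\<exists>G\<in>C. eventually P G)"
proof (rule eventually_Inf_base)
  fix F G assume "F \<in> C" "G \<in> C"
  then show "\<exists>x\<in>C. x \<le> inf F G"
    using assms(2)[of F G] by (metis inf.orderE inf.commute order_refl)
qed fact

text \<open>Compactness in the form used here: what holds eventually for the infimum of a chain
  already does so for some member, so \<open>False\<close> cannot first appear in the limit.\<close>

lemma Inf_chain_neq_bot:
  assumes "C \<noteq> {}" "\<And>G. G \<in> C \<Longrightarrow> G \<noteq> bot" "\<And>G H. G \<in> C \<Longrightarrow> H \<in> C \<Longrightarrow> G \<le> H \<or> H \<le> G"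
  shows "Inf C \<noteq> (bot :: 'a filter)"
  using eventually_Inf_chain[OF assms(1,3), of "\<lambda>_. False"] assms(2)
  by (auto simp: trivial_limit_def)

lemma ultrafilter_not_iff:
  assumes "p \<in> ultrafilters"
  shows "eventually (\<lambda>x. \<not> P x) p \<longleftrightarrow> \<not> eventually P p"
proof -
  have "\<not> (eventually P p \<and> eventually (\<lambda>x. \<not> P x) p)"
    using assms eventually_conj[of P p "\<lambda>x. \<not> P x"]
    by (auto simp: ultrafilters_def trivial_limit_def)
  then show ?thesis
    using assms by (auto simp: ultrafilters_def)
qed

text \<open>A set in \<open>q\<close> but not in \<open>p\<close> would have its complement in
  \<open>p\<close>, hence also in \<open>q\<close>. Inclusions between ultrafilters become equations
  this way.\<close>

lemma ultrafilter_le_eq: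
  assumes "p \<in> ultrafilters" "q \<noteq> bot" "q \<le> p"
  shows "q = p"
proof (rule antisym)
  show "p \<le> q"
  proof (rule filter_leI)
    fix P assume P: "eventually P q"
    show "eventually P p"
    proof (rule ccontr)
      assume "\<not> eventually P p"
      then have "eventually (\<lambda>x. \<not> P x) q"
        using assms(1,3) by (auto simp: ultrafilter_not_iff intro: filter_leD)
      then have "eventually (\<lambda>x. False) q"
        using P by eventually_elim simp
      then show False
        using assms(2) by (simp add: trivial_limit_def)
    qed
  qed
qed fact

lemma ultrafilter_neq_bot: "p \<in> ultrafilters \<Longrightarrow> p \<noteq> bot"
  by (simp add: ultrafilters_def)

lemma ultrafilter_below_exists:
  fixes F :: "'a filter"
  assumes "F \<noteq> bot"
  obtains p where "p \<in> ultrafilters" "p \<le> F"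
proof -
  obtain M where M: "M \<noteq> bot" "M \<le> F" and min: "\<And>N. N \<noteq> bot \<Longrightarrow> N \<le> M \<Longrightarrow> N = M"
  proof (rule minimal_filter_exists[of "\<lambda>G. G \<noteq> bot" F])
    show "F \<noteq> bot" by fact
  qed (use Inf_chain_neq_bot in blast)+
  \<comment> \<open>Either \<open>P\<close> is incompatible with \<open>M\<close>, which then
    contains the complement, or adding \<open>P\<close> keeps \<open>M\<close> proper, and by
    minimality \<open>P\<close> was there already.\<close>
  have "eventually P M \<or> eventually (\<lambda>x. \<not> P x) M" for P
  proof (cases "inf M (principal {x. P x}) = bot")
    case True
    then show ?thesis
      by (simp add: trivial_limit_def eventually_inf_principal)
  next
    case False
    then have "inf M (principal {x. P x}) = M"
      by (intro min) auto
    then have "M \<le> principal {x. P x}"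
      by (metis inf.cobounded2)
    then show ?thesis
      by (simp add: le_principal)
  qed
  then show thesis
    using M that by (auto simp: ultrafilters_def)
qed

lemma ultrafilter_finite_range:
  assumes "p \<in> ultrafilters" "finite (range c)"
  obtains z where "eventually (\<lambda>w. c w = c z) p"
proof -
  have "\<exists>v\<in>range c. eventually (\<lambda>w. c w = v) p"
  proof (rule ccontr)
    assume "\<not> ?thesis"
    then have "\<forall>v\<in>range c. eventually (\<lambda>w. c w \<noteq> v) p"
      using assms(1) by (simp add: ultrafilter_not_iff)
    then have "eventually (\<lambda>w. \<forall>v\<in>range c. c w \<noteq> v) p"
      by (intro eventually_ball_finite assms(2))
    then show False
      using eventually_happens'[OF ultrafilter_neq_bot[OF assms(1)]] by blast
  qed
  then show thesis using that by auto
qed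

lemma principal_in_ultrafilters: "principal {x} \<in> ultrafilters"
  by (auto simp: ultrafilters_def eventually_principal principal_eq_bot_iff)

lemma filtermap_in_ultrafilters: "p \<in> ultrafilters \<Longrightarrow> filtermap f p \<in> ultrafilters"
  by (auto simp: ultrafilters_def eventually_filtermap filtermap_bot_iff)

lemma filter_add_mono: "p \<le> p' \<Longrightarrow> q \<le> q' \<Longrightarrow> p \<oplus> q \<le> p' \<oplus> q'"
  by (auto simp: le_filter_def eventually_filter_add elim!: eventually_mono)

lemma filter_add_assoc: "(p \<oplus> q) \<oplus> r = p \<oplus> (q \<oplus> r)" for p :: "'a::semigroup_add filter"
  by (simp add: filter_eq_iff eventually_filter_add add.assoc)

lemma filter_add_neq_bot: "p \<noteq> bot \<Longrightarrow> q \<noteq> bot \<Longrightarrow> p \<oplus> q \<noteq> bot"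
  by (simp add: trivial_limit_def eventually_filter_add)

text \<open>With filters read as closed sets, this is the preimage of \<open>e\<close> under right
  translation by \<open>p\<close>: by \<open>le_residual_iff\<close>, the largest \<open>G\<close>
  with \<open>G \<oplus> p \<le> e\<close>.\<close>

definition residual :: "'a::plus filter \<Rightarrow> 'a filter \<Rightarrow> 'a filter" where
  "residual e p =
     Abs_filter (\<lambda>P. \<exists>A. eventually A e \<and> (\<forall>x. eventually (\<lambda>y. A (x + y)) p \<longrightarrow> P x))"

lemma eventually_residual:
  "eventually P (residual e p) \<longleftrightarrow>
     (\<exists>A. eventually A e \<and> (\<forall>x. eventually (\<lambda>y. A (x + y)) p \<longrightarrow> P x))"
  unfolding residual_def
proof (rule eventually_Abs_filter, standard, goal_cases)
  case 1
  show ?case by (intro exI[of _ "\<lambda>_. True"]) auto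
next
  case (2 P Q)
  then obtain A B where AB: "eventually A e" "\<And>x. eventually (\<lambda>y. A (x + y)) p \<Longrightarrow> P x"
    "eventually B e" "\<And>x. eventually (\<lambda>y. B (x + y)) p \<Longrightarrow> Q x" by blast
  show ?case
    using AB by (intro exI[of _ "\<lambda>z. A z \<and> B z"]) (auto simp: eventually_conj_iff)
next
  case (3 P Q)
  then show ?case by blast
qed

lemma le_residual_iff: "G \<le> residual e p \<longleftrightarrow> G \<oplus> p \<le> e"
proof
  assume G: "G \<le> residual e p"
  show "G \<oplus> p \<le> e"
  proof (rule filter_leI)
    fix A assume "eventually A e"
    then have "eventually (\<lambda>x. eventually (\<lambda>y. A (x + y)) p) (residual e p)"
      unfolding eventually_residual by blast
    then show "eventually A (G \<oplus> p)"
      unfolding eventually_filter_add by (rule filter_leD[OF G])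
  qed
next
  assume G: "G \<oplus> p \<le> e"
  show "G \<le> residual e p"
  proof (rule filter_leI)
    fix P assume "eventually P (residual e p)"
    then obtain A where A: "eventually A e" "\<And>x. eventually (\<lambda>y. A (x + y)) p \<Longrightarrow> P x"
      by (auto simp: eventually_residual)
    have "eventually (\<lambda>x. eventually (\<lambda>y. A (x + y)) p) G"
      using filter_leD[OF G A(1)] by (simp add: eventually_filter_add)
    then show "eventually P G"
      by eventually_elim (rule A(2))
  qed
qed

text \<open>This yields an \<open>r\<close> below \<open>F\<close> with
  \<open>r \<oplus> p \<le> e\<close>. If the infimum were trivial, then, \<open>p\<close> being an
  ultrafilter, \<open>F \<oplus> p\<close> would contain the complement of a set of
  \<open>e\<close>.\<close>

lemma inf_residual_neq_bot:
  assumes "p \<in> ultrafilters" "e \<noteq> bot" "e \<le> F \<oplus> p"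
  shows "inf F (residual e p) \<noteq> bot"
proof
  assume "inf F (residual e p) = bot"
  then obtain Q A where Q: "eventually Q F" and A: "eventually A e"
    and QA: "\<And>x. Q x \<Longrightarrow> \<not> eventually (\<lambda>y. A (x + y)) p"
    by (auto simp: trivial_limit_def eventually_inf eventually_residual)
  have "eventually (\<lambda>x. eventually (\<lambda>y. \<not> A (x + y)) p) F"
    using Q by eventually_elim (simp add: QA ultrafilter_not_iff[OF assms(1)])
  then have "eventually (\<lambda>z. \<not> A z) e"
    using assms(3) by (auto simp: le_filter_def eventually_filter_add)
  with A have "eventually (\<lambda>_. False) e"
    by eventually_elim simp
  then show False
    using assms(2) by (simp add: trivial_limit_def)
qed

text \<open>A nontrivial filter \<open>F\<close> with \<open>F \<oplus> F \<le> F\<close> plays the part of a closed subsemigroup of the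
  space of ultrafilters in the Ellis--Numakura argument.\<close>

lemma idempotent_ultrafilter_below:
  fixes F :: "'a::semigroup_add filter"
  assumes "F \<noteq> bot" "F \<oplus> F \<le> F"
  obtains e where "e \<in> ultrafilters" "e \<le> F" "e \<oplus> e = e"
proof -
  let ?P = "\<lambda>G :: 'a filter. G \<noteq> bot \<and> G \<oplus> G \<le> G"
  have chain: "?P (Inf C)" if C: "C \<noteq> {}" "\<And>G. G \<in> C \<Longrightarrow> ?P G"
    "\<And>G H. G \<in> C \<Longrightarrow> H \<in> C \<Longrightarrow> G \<le> H \<or> H \<le> G" for C
  proof
    show "Inf C \<noteq> bot"
      using C by (intro Inf_chain_neq_bot) auto
    show "Inf C \<oplus> Inf C \<le> Inf C"
    proof (rule Inf_greatest)
      fix G assume G: "G \<in> C"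
      then have "Inf C \<oplus> Inf C \<le> G \<oplus> G"
        by (intro filter_add_mono Inf_lower)
      with C(2)[OF G] show "Inf C \<oplus> Inf C \<le> G" by auto
    qed
  qed
  obtain M where M: "?P M" "M \<le> F" and min: "\<And>N. ?P N \<Longrightarrow> N \<le> M \<Longrightarrow> N = M"
  proof (rule minimal_filter_exists[of ?P F])
    show "?P F" using assms by simp
  qed (use chain in simp_all)
  obtain p where p: "p \<in> ultrafilters" "p \<le> M"
    using M ultrafilter_below_exists by metis
  note p0 = ultrafilter_neq_bot[OF p(1)]
  have Mp: "M \<oplus> p \<le> M"
    using M p(2) filter_add_mono[of M M p M] by auto
  have "(M \<oplus> p) \<oplus> (M \<oplus> p) \<le> M \<oplus> (M \<oplus> p)"
    by (intro filter_add_mono Mp order_refl)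
  also have "\<dots> \<le> M \<oplus> p"
    using filter_add_mono[of "M \<oplus> M" M p p] M(1) by (simp add: filter_add_assoc)
  finally have "(M \<oplus> p) \<oplus> (M \<oplus> p) \<le> M \<oplus> p" .
  \<comment> \<open>\<open>M \<oplus> p\<close> is a closed subsemigroup inside \<open>M\<close>, so
    minimality forces equality. In particular \<open>p\<close> lies below
    \<open>M \<oplus> p\<close>, which makes \<open>?G\<close> nontrivial.\<close>
  then have Mp_eq: "M \<oplus> p = M"
    using M(1) p0 Mp filter_add_neq_bot[of M p] by (intro min) auto
  \<comment> \<open>The stabilizer of \<open>p\<close> in \<open>M\<close> is again a closed
    subsemigroup. Minimality makes it all of \<open>M\<close>, so \<open>p\<close> stabilizes
    itself.\<close>
  let ?G = "inf M (residual p p)"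
  have G: "?G \<oplus> p \<le> p"
    using le_residual_iff[of ?G p p] by simp
  have "(?G \<oplus> ?G) \<oplus> p \<le> p"
    using filter_add_mono[OF order_refl G, of ?G] G by (auto simp: filter_add_assoc)
  moreover have "?G \<oplus> ?G \<le> M"
    using filter_add_mono[of ?G M ?G M] M(1) by auto
  ultimately have "?G \<oplus> ?G \<le> ?G"
    by (simp add: le_residual_iff)
  moreover have "?G \<noteq> bot"
    using p p0 Mp_eq by (intro inf_residual_neq_bot) auto
  ultimately have "?G = M"
    by (intro min) auto
  then have "M \<le> residual p p"
    by (metis inf.cobounded2)
  then have "p \<oplus> p \<le> p"
    using p(2) by (simp add: order_trans flip: le_residual_iff)
  then have "p \<oplus> p = p"
    using p by (intro ultrafilter_le_eq filter_add_neq_bot p0)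
  then show thesis
    using that p M by auto
qed

text \<open>The idempotent is sought below \<open>F \<oplus> p\<close> rather than just below
  \<open>F\<close>: there it must have the form \<open>r \<oplus> p\<close>, which puts it into the
  left ideal.\<close>

lemma idempotent_in_left_ideal:
  fixes F :: "'a::semigroup_add filter"
  assumes F: "F \<oplus> F \<le> F" and p: "p \<in> ultrafilters" "p \<le> F" "p \<in> I"
    and I: "\<And>r q. r \<in> ultrafilters \<Longrightarrow> q \<in> I \<Longrightarrow> r \<oplus> q \<in> I"
  obtains e where "e \<in> ultrafilters" "e \<le> F" "e \<oplus> e = e" "e \<in> I"
proof -
  note p0 = ultrafilter_neq_bot[OF p(1)]
  have F0: "F \<noteq> bot"
    using p(2) p0 bot.extremum_uniqueI by auto
  have Fp: "F \<oplus> p \<le> F"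
    using F p(2) filter_add_mono[of F F p F] by auto
  have "(F \<oplus> p) \<oplus> (F \<oplus> p) \<le> F \<oplus> (F \<oplus> p)"
    by (intro filter_add_mono Fp order_refl)
  also have "\<dots> \<le> F \<oplus> p"
    using filter_add_mono[OF F order_refl, of p] by (simp add: filter_add_assoc)
  finally obtain e where e: "e \<in> ultrafilters" "e \<le> F \<oplus> p" "e \<oplus> e = e"
    using idempotent_ultrafilter_below[of "F \<oplus> p"] F0 p0 filter_add_neq_bot by metis
  have "inf F (residual e p) \<noteq> bot"
    using e p ultrafilter_neq_bot by (intro inf_residual_neq_bot) auto
  then obtain r where r: "r \<in> ultrafilters" "r \<le> inf F (residual e p)"
    using ultrafilter_below_exists by metis
  then have "r \<oplus> p \<le> e"
    by (simp flip: le_residual_iff)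
  then have "r \<oplus> p = e"
    using e(1) r(1) p0 by (intro ultrafilter_le_eq filter_add_neq_bot) (auto simp: ultrafilter_neq_bot)
  then have "e \<in> I"
    using I r p by blast
  then show thesis
    using that e Fp by (meson order_trans)
qed


section \<open>Sums of tails of a sequence\<close>

lemma FS_antimono: "m \<le> n \<Longrightarrow> FS x n \<subseteq> FS x m"
  by (fastforce simp: FS_def)

text \<open>The ultrafilters below it are exactly those in every
  \<open>beta_closure (FS x m)\<close> with \<open>m \<ge> 1\<close>.\<close>

definition FS_filter :: "(nat \<Rightarrow> 'a::comm_monoid_add) \<Rightarrow> 'a filter" where
  "FS_filter x = (INF m\<in>{1..}. principal (FS x m))"

lemma eventually_FS_filter:
  "eventually P (FS_filter x) \<longleftrightarrow> (\<exists>m\<ge>1. \<forall>z\<in>FS x m. P z)"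
  unfolding FS_filter_def
proof (subst eventually_INF_base)
  fix a b :: nat assume "a \<in> {1..}" "b \<in> {1..}"
  then show "\<exists>c\<in>{1..}. principal (FS x c) \<le> inf (principal (FS x a)) (principal (FS x b))"
    using FS_antimono[of a "max a b" x] FS_antimono[of b "max a b" x]
    by (intro bexI[of _ "max a b"]) auto
qed (auto simp: eventually_principal)

text \<open>Starting beyond the largest index used for \<open>z\<close> keeps the two index sets
  disjoint.\<close>

lemma FS_translate:
  assumes "z \<in> FS x m"
  obtains n where "n \<ge> 1" "\<And>w. w \<in> FS x n \<Longrightarrow> z + w \<in> FS x m"
proof -
  obtain F where F: "finite F" "F \<noteq> {}" "F \<subseteq> {m..}" "z = (\<Sum>n\<in>F. x n)"
    using assms by (auto simp: FS_def)
  show thesis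
  proof (rule that[of "Suc (Max F)"])
    fix w assume "w \<in> FS x (Suc (Max F))"
    then obtain G where G: "finite G" "G \<noteq> {}" "G \<subseteq> {Suc (Max F)..}" "w = (\<Sum>n\<in>G. x n)"
      by (auto simp: FS_def)
    have "F \<inter> G = {}"
      using F(1) G(3) by (fastforce dest: Max_ge)
    then have "z + w = (\<Sum>n\<in>F \<union> G. x n)"
      using F G by (simp add: sum.union_disjoint)
    moreover have "m \<le> Max F"
      using F(3) Max_in[OF F(1,2)] by auto
    then have "F \<union> G \<subseteq> {m..}"
      using F G by fastforce
    ultimately show "z + w \<in> FS x m"
      using F G unfolding FS_def by (intro CollectI exI[of _ "F \<union> G"]) auto
  qed simp
qed

text \<open>The tail given by \<open>FS_translate\<close> depends on \<open>z\<close>, which the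
  nested form of \<open>\<oplus>\<close> permits.\<close>

lemma FS_filter_add_le: "FS_filter x \<oplus> FS_filter x \<le> FS_filter x"
proof (rule filter_leI)
  fix P assume "eventually P (FS_filter x)"
  then obtain m where m: "m \<ge> 1" "\<And>z. z \<in> FS x m \<Longrightarrow> P z"
    by (auto simp: eventually_FS_filter)
  show "eventually P (FS_filter x \<oplus> FS_filter x)"
    unfolding eventually_filter_add eventually_FS_filter
  proof (rule exI[of _ m], intro conjI ballI)
    fix z assume "z \<in> FS x m"
    then obtain n where "n \<ge> 1" "\<And>w. w \<in> FS x n \<Longrightarrow> z + w \<in> FS x m"
      using FS_translate by metis
    then show "\<exists>n\<ge>1. \<forall>w\<in>FS x n. P (z + w)"
      using m by blast
  qed fact
qed

lemma FS_idempotent_in_left_ideal: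
  fixes x :: "nat \<Rightarrow> 'a::comm_monoid_add"
  assumes "(\<Inter>m\<in>{1..}. beta_closure (FS x m)) \<inter> I \<noteq> {}"
    and I: "\<And>r q. r \<in> ultrafilters \<Longrightarrow> q \<in> I \<Longrightarrow> r \<oplus> q \<in> I"
  obtains e where "e \<in> ultrafilters" "e \<oplus> e = e" "e \<in> I"
    "\<And>m. m \<ge> 1 \<Longrightarrow> eventually (\<lambda>z. z \<in> FS x m) e"
proof -
  obtain p where p: "p \<in> I" "\<And>m. m \<ge> 1 \<Longrightarrow> p \<in> beta_closure (FS x m)"
    using assms(1) by auto
  then have "p \<in> ultrafilters"
    by (auto simp: beta_closure_def)
  moreover have "p \<le> FS_filter x"
    unfolding FS_filter_def using p by (auto intro!: INF_greatest simp: le_principal beta_closure_def)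
  ultimately obtain e where e: "e \<in> ultrafilters" "e \<le> FS_filter x" "e \<oplus> e = e" "e \<in> I"
    using idempotent_in_left_ideal[OF FS_filter_add_le, of p x I] p I by metis
  have "eventually (\<lambda>z. z \<in> FS x m) e" if "m \<ge> 1" for m
    using e(2) that by (auto simp: le_filter_def eventually_FS_filter)
  then show thesis using that e by blast
qed


section \<open>Scaling ultrafilters\<close>

lemma filtermap_times_filter_add:
  "filtermap ((*) a) (p \<oplus> q) = filtermap ((*) a) p \<oplus> filtermap ((*) a) q"
  for a :: "'a::semiring"
  by (simp add: filter_eq_iff eventually_filtermap eventually_filter_add distrib_left)

text \<open>The coset of \<open>z\<close> modulo the ideal generated by \<open>a\<close>; finiteness
  of \<open>range (residue a)\<close> encodes that the quotient ring is finite.\<close>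

definition residue :: "'a::comm_ring_1 \<Rightarrow> 'a \<Rightarrow> 'a set" where
  "residue a z = {w. a dvd w - z}"

lemma residue_eq_iff: "residue a z = residue a w \<longleftrightarrow> a dvd z - w"
proof
  assume "residue a z = residue a w"
  moreover have "z \<in> residue a z" by (simp add: residue_def)
  ultimately show "a dvd z - w" by (auto simp: residue_def)
next
  assume *: "a dvd z - w"
  have "a dvd u - z \<longleftrightarrow> a dvd u - w" for u
    using * dvd_add[of a "u - z" "z - w"] dvd_diff[of a "u - w" "z - w"] by auto
  then show "residue a z = residue a w" by (simp add: residue_def)
qed

lemma smallest_ideal_scale:
  fixes a :: "'a::comm_ring_1"
  assumes fin: "finite (range (residue a))" and p: "p \<in> smallest_ideal"
  shows "filtermap ((*) a) p \<in> smallest_ideal"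
  unfolding smallest_ideal_def
proof
  fix I :: "'a filter set" assume "I \<in> {I. beta_ideal I}"
  then have I: "I \<noteq> {}" "I \<subseteq> ultrafilters"
    "\<And>p q. p \<in> I \<Longrightarrow> q \<in> ultrafilters \<Longrightarrow> p \<oplus> q \<in> I \<and> q \<oplus> p \<in> I"
    by (auto simp: beta_ideal_def)
  \<comment> \<open>Absorption is inherited from \<open>I\<close>; the work lies in finding an
    element \<open>r\<close>.\<close>
  let ?J = "{q \<in> ultrafilters. filtermap ((*) a) q \<in> I}"
  obtain q where q: "q \<in> I" using I by auto
  obtain z where z: "eventually (\<lambda>w. residue a w = residue a z) q"
    using ultrafilter_finite_range[OF _ fin] q I(2) by blast
  \<comment> \<open>Translation by \<open>-z\<close> moves the residue class of \<open>z\<close>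
    onto the multiples of \<open>a\<close> and does not leave the ideal \<open>I\<close>.\<close>
  let ?q = "principal {-z} \<oplus> q"
  have q': "?q \<in> I"
    using I(3)[OF q principal_in_ultrafilters] ..
  have "eventually (\<lambda>w. a dvd w) ?q"
    using z by (simp add: eventually_filter_add eventually_principal residue_eq_iff)
  then have "\<exists>z. P (a * z)" if "eventually P ?q" for P
    using eventually_happens'[OF ultrafilter_neq_bot eventually_conj[OF that]] q' I(2)
    by (metis dvdE subsetD)
  \<comment> \<open>Every set of \<open>?q\<close> contains a multiple of \<open>a\<close>, so its
    preimage is nonempty.\<close>
  then have "filtercomap ((*) a) ?q \<noteq> bot"
    by (fastforce simp: trivial_limit_def eventually_filtercomap)
  then obtain r where r: "r \<in> ultrafilters" "r \<le> filtercomap ((*) a) ?q"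
    using ultrafilter_below_exists by metis
  have "filtermap ((*) a) r \<le> ?q"
    using r(2) by (simp add: filtermap_le_iff_le_filtercomap)
  then have "filtermap ((*) a) r = ?q"
    using r(1) q' I(2) by (intro ultrafilter_le_eq) (auto simp: filtermap_bot_iff ultrafilter_neq_bot)
  then have "beta_ideal ?J"
    unfolding beta_ideal_def
    using r q' I(3) by (auto simp: filtermap_times_filter_add filter_add_in_ultrafilters
        filtermap_in_ultrafilters)
  then show "filtermap ((*) a) p \<in> I"
    using p by (auto simp: smallest_ideal_def)
qed

section \<open>Absorption and nonprincipality in the smallest ideal\<close>

lemma smallest_ideal_left:
  assumes "r \<in> ultrafilters" "q \<in> smallest_ideal"
  shows "r \<oplus> q \<in> smallest_ideal"
  using assms by (auto simp: smallest_ideal_def beta_ideal_def)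

text \<open>The nonprincipal ultrafilters form an ideal, nonempty because the group is
  infinite.\<close>

lemma smallest_ideal_nonprincipal:
  fixes p :: "'a::group_add filter"
  assumes inf: "infinite (UNIV :: 'a set)" and p: "p \<in> smallest_ideal"
  shows "\<not> eventually (\<lambda>x. x = z) p"
proof -
  let ?I = "{p :: 'a filter. p \<in> ultrafilters \<and> (\<forall>z. \<not> eventually (\<lambda>x. x = z) p)}"
  have "cofinite \<noteq> (bot :: 'a filter)"
    using inf by (simp add: cofinite_bot)
  then obtain u :: "'a filter" where u: "u \<in> ultrafilters" "u \<le> cofinite"
    using ultrafilter_below_exists by metis
  have "eventually (\<lambda>x. x \<noteq> z) u" for z
    using u(2) by (rule filter_leD) (simp add: eventually_cofinite)
  then have "u \<in> ?I"
    using u(1) by (auto simp: ultrafilter_not_iff)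
  moreover have "p \<oplus> q \<in> ?I" "q \<oplus> p \<in> ?I" if p: "p \<in> ?I" and q: "q \<in> ultrafilters" for p q
  proof -
    have *: "x + y = z \<longleftrightarrow> y = - x + z" for x y z :: 'a
      by (metis add.assoc add.left_neutral add.right_inverse add.left_inverse)
    have "\<not> eventually (\<lambda>x. x = z) (q \<oplus> p)" for z
      using p ultrafilter_neq_bot[OF q] by (simp add: eventually_filter_add * trivial_limit_def)
    then show "q \<oplus> p \<in> ?I"
      using p q by (auto intro: filter_add_in_ultrafilters)
    \<comment> \<open>If \<open>q\<close> is concentrated on the solutions \<open>y\<close> of both
      \<open>x + y = z\<close> and \<open>x' + y = z\<close>, cancelling such a \<open>y\<close>
      gives \<open>x' = x\<close>, so \<open>p\<close> would be principal.\<close>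
    have "\<not> eventually (\<lambda>x. x = z) (p \<oplus> q)" for z
    proof
      assume "eventually (\<lambda>x. x = z) (p \<oplus> q)"
      then have ev: "eventually (\<lambda>x. eventually (\<lambda>y. x + y = z) q) p"
        by (simp add: eventually_filter_add)
      then obtain x where x: "eventually (\<lambda>y. x + y = z) q"
        using p eventually_happens' ultrafilter_neq_bot by blast
      have "eventually (\<lambda>x'. x' = x) p"
        using ev
      proof eventually_elim
        case (elim x')
        with x have "eventually (\<lambda>y. x + y = x' + y) q" by eventually_elim simp
        then show ?case
          using ultrafilter_neq_bot[OF q] eventually_happens' by fastforce
      qed
      then show False using p by auto
    qed
    then show "p \<oplus> q \<in> ?I"
      using p q by (auto intro: filter_add_in_ultrafilters)
  qed
  ultimately have "beta_ideal ?I"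
    unfolding beta_ideal_def by blast
  then have "p \<in> ?I"
    using p unfolding smallest_ideal_def by blast
  then show ?thesis by blast
qed

section \<open>\<open>J\<close>-sets under translation and scaling\<close>

lemma J_set_mono: "J_set A \<Longrightarrow> A \<subseteq> B \<Longrightarrow> J_set B"
  unfolding J_set_def by (meson subsetD)

lemma J_set_translate: "J_set {y. x + y \<in> A} \<Longrightarrow> J_set A"
  unfolding J_set_def by (metis (no_types, lifting) add.assoc mem_Collect_eq)

text \<open>A set of \<open>r \<oplus> q\<close> has a translate in \<open>q\<close>, and the
  translation is absorbed by the free shift in the definition of a \<open>J\<close>-set.\<close>

lemma J_ultrafilters_left:
  assumes "r \<in> ultrafilters" "q \<in> J_ultrafilters"
  shows "r \<oplus> q \<in> J_ultrafilters"
proof -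
  have "J_set A" if A: "eventually (\<lambda>z. z \<in> A) (r \<oplus> q)" for A
  proof -
    obtain x where "eventually (\<lambda>y. x + y \<in> A) q"
      using A eventually_happens' ultrafilter_neq_bot[OF assms(1)]
      unfolding eventually_filter_add by blast
    then have "J_set {y. x + y \<in> A}"
      using assms(2) by (simp add: J_ultrafilters_def)
    then show ?thesis by (rule J_set_translate)
  qed
  then show ?thesis
    using assms by (auto simp: J_ultrafilters_def filter_add_in_ultrafilters)
qed

text \<open>With the same shift and the same \<open>H\<close>, the constant sequences 0 and 1 give
  values differing by \<open>card H\<close>, which is nonzero in characteristic 0.\<close>

lemma not_J_set_singleton: "\<not> J_set {z :: 'a::ring_char_0}"
proof
  assume "J_set {z}"
  from this[unfolded J_set_def, rule_format, of "{\<lambda>_. 0, \<lambda>_. 1}"]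
  obtain a H where "finite H" "H \<noteq> {}" "a = z" "a + of_nat (card H) = z"
    by auto
  then show False by simp
qed

text \<open>By pigeonhole, infinitely many partial sums agree modulo \<open>a\<close>, simultaneously for the given
  finitely many sequences; cutting at these places gives blocks whose sums are multiples of \<open>a\<close>.\<close>

lemma divisible_blocks:
  fixes a :: "'a::comm_ring_1"
  assumes fin: "finite (range (residue a))" and F: "finite F"
  obtains N :: "nat \<Rightarrow> nat" where "strict_mono N"
    "\<And>f k. f \<in> F \<Longrightarrow> a dvd (\<Sum>t\<in>{N k<..N (Suc k)}. f t)"
proof -
  \<comment> \<open>Restricting the function to \<open>F\<close> places all colours in a finite
    extensional function space.\<close>
  define c where "c n = (\<lambda>f\<in>F. residue a (\<Sum>t\<le>n. f t))" for n :: nat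
  have "range c \<subseteq> F \<rightarrow>\<^sub>E range (residue a)" by (auto simp: c_def)
  then have "finite (range c)"
    by (rule finite_subset) (intro finite_PiE fin F)
  then obtain n0 where n0: "infinite {n. c n = c n0}"
    using pigeonhole_infinite[of UNIV c] by auto
  define N where "N = enumerate {n. c n = c n0}"
  have N: "c (N k) = c n0" for k
    using enumerate_in_set[OF n0, of k] by (simp add: N_def)
  have mono: "strict_mono N"
    unfolding N_def using n0 by (rule strict_mono_enumerate)
  show thesis
  proof (rule that[OF mono])
    fix f k assume f: "f \<in> F"
    have "N k \<le> N (Suc k)"
      using mono by (simp add: strict_mono_less_eq)
    moreover have "{..N (Suc k)} - {..N k} = {N k<..N (Suc k)}" by auto
    ultimately have "(\<Sum>t\<in>{N k<..N (Suc k)}. f t) = (\<Sum>t\<le>N (Suc k). f t) - (\<Sum>t\<le>N k. f t)"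
      using sum_diff[of "{..N (Suc k)}" "{..N k}" f] by simp
    also have "a dvd \<dots>"
    proof -
      have "c (N (Suc k)) f = c (N k) f"
        by (simp add: N)
      then show ?thesis
        using f by (simp add: c_def residue_eq_iff)
    qed
    finally show "a dvd (\<Sum>t\<in>{N k<..N (Suc k)}. f t)" .
  qed
qed

text \<open>The hypothesis on \<open>A\<close> is applied to the sequences of block sums divided by
  \<open>a\<close>. Multiplying by \<open>a\<close> and replacing each chosen index by its block
  gives the claim for \<open>F\<close>.\<close>

lemma J_set_scale:
  fixes a :: "'a::comm_ring_1"
  assumes fin: "finite (range (residue a))" and A: "J_set A"
  shows "J_set ((*) a ` A)"
  unfolding J_set_def
proof (intro allI impI, elim conjE)
  fix F :: "(nat \<Rightarrow> 'a) set" assume F: "finite F" "F \<noteq> {}"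
  obtain N where N: "strict_mono N"
    "\<And>f k. f \<in> F \<Longrightarrow> a dvd (\<Sum>t\<in>{N k<..N (Suc k)}. f t)"
    using divisible_blocks[OF fin F(1)] by metis
  \<comment> \<open>Left-open blocks are disjoint and never contain the index 0.\<close>
  define B where "B k = {N k<..N (Suc k)}" for k
  have disj: "B j \<inter> B k = {}" if "j < k" for j k
    using strict_mono_less_eq[OF N(1), of "Suc j" k] that by (auto simp: B_def)
  have "\<forall>f k. \<exists>c. f \<in> F \<longrightarrow> (\<Sum>t\<in>B k. f t) = a * c"
    using N(2) unfolding B_def dvd_def by blast
  then obtain g where g: "\<And>f k. f \<in> F \<Longrightarrow> (\<Sum>t\<in>B k. f t) = a * g f k" by metis
  obtain b K where K: "finite K" "K \<noteq> {}" "\<And>f. f \<in> F \<Longrightarrow> b + (\<Sum>k\<in>K. g f k) \<in> A"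
    using A[unfolded J_set_def, rule_format, of "g ` F"] F by auto
  let ?H = "\<Union>k\<in>K. B k"
  have "a * b + (\<Sum>t\<in>?H. f t) = a * (b + (\<Sum>k\<in>K. g f k))" if "f \<in> F" for f
  proof -
    have "(\<Sum>t\<in>?H. f t) = (\<Sum>k\<in>K. \<Sum>t\<in>B k. f t)"
      using K(1) disj by (intro sum.UNION_disjoint) (auto simp: B_def neq_iff)
    then show ?thesis
      using that by (simp add: g distrib_left sum_distrib_left)
  qed
  then have "\<forall>f\<in>F. a * b + (\<Sum>t\<in>?H. f t) \<in> (*) a ` A"
    using K(3) by auto
  moreover have "B k \<noteq> {}" for k
    using strict_mono_less[OF N(1), of k "Suc k"] by (auto simp: B_def)
  then have "finite ?H" "?H \<noteq> {}" "?H \<subseteq> {1..}"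
    using K by (auto simp: B_def)
  ultimately show "\<exists>a' H. finite H \<and> H \<noteq> {} \<and> H \<subseteq> {1..} \<and> (\<forall>f\<in>F. a' + (\<Sum>t\<in>H. f t) \<in> (*) a ` A)"
    by blast
qed

lemma J_ultrafilters_scale:
  fixes a :: "'a::comm_ring_1"
  assumes fin: "finite (range (residue a))" and p: "p \<in> J_ultrafilters"
  shows "filtermap ((*) a) p \<in> J_ultrafilters"
proof -
  have "J_set B" if "eventually (\<lambda>z. z \<in> B) (filtermap ((*) a) p)" for B
  proof -
    have "J_set {z. a * z \<in> B}"
      using p that by (auto simp: J_ultrafilters_def eventually_filtermap)
    from J_set_scale[OF fin this] show ?thesis
      by (rule J_set_mono) auto
  qed
  then show ?thesis
    using p by (auto simp: J_ultrafilters_def filtermap_in_ultrafilters)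
qed


section \<open>Choosing the sum subsystem\<close>

text \<open>Idempotence keeps the construction going: for \<open>e\<close>-most \<open>y\<close>,
  the new sum \<open>s + y\<close> lies in \<open>A\<close> and can be extended within
  \<open>A\<close> in the same way as \<open>s\<close>.\<close>

lemma eventually_idempotent_translate:
  fixes s :: "'a::semigroup_add"
  assumes "e \<oplus> e = e" and "eventually (\<lambda>y. s + y \<in> A) e"
  shows "eventually (\<lambda>y. s + y \<in> A \<and> eventually (\<lambda>z. s + y + z \<in> A) e) e"
proof -
  have "eventually (\<lambda>y. s + y \<in> A) (e \<oplus> e)"
    using assms by simp
  then have "eventually (\<lambda>y. eventually (\<lambda>z. s + y + z \<in> A) e) e"
    by (simp add: eventually_filter_add add.assoc)
  then show ?thesis
    using assms(2) by (simp add: eventually_conj_iff)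
qed

text \<open>In a state \<open>(S, P, m)\<close> of the construction, \<open>S\<close> and \<open>P\<close> collect the sums and the products of
  the terms chosen so far (with the empty sum and the empty product), and the next term is to be
  a sum over indices \<open>\<ge> m\<close>.\<close>

lemma sum_subsystem_FS_FP:
  fixes e :: "'a::idom filter"
  assumes e: "e \<noteq> bot" "e \<oplus> e = e" and FS: "\<And>m. m \<ge> 1 \<Longrightarrow> eventually (\<lambda>z. z \<in> FS x m) e"
    and nz: "eventually (\<lambda>z. z \<noteq> 0) e"
    and A: "\<And>a. a \<noteq> 0 \<Longrightarrow> eventually (\<lambda>z. a * z \<in> A) e"
  shows "\<exists>y. sum_subsystem y x \<and> FS y 1 \<union> FP y 1 \<subseteq> A"
proof -
  \<comment> \<open>Sums carry an extension condition, while products need only be nonzero, since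
    \<open>A\<close> can be reached from every nonzero factor. Nonzero terms preserve this in a
    domain.\<close>
  define good where "good = (\<lambda>(S, P :: 'a set, m :: nat). finite S \<and> finite P \<and> 0 \<in> S \<and> 1 \<in> P \<and> 0 \<notin> P \<and>
      m \<ge> 1 \<and> (\<forall>s\<in>S. eventually (\<lambda>y. s + y \<in> A) e))"
  define step where "step = (\<lambda>H y (S, P, m) (S', P', m'). finite H \<and> H \<noteq> {} \<and> H \<subseteq> {m..<m'} \<and>
      y = (\<Sum>t\<in>H. x t) \<and> S' = S \<union> (\<lambda>s. s + y) ` S \<and> P' = P \<union> (\<lambda>a. a * y) ` P \<and>
      (\<lambda>s. s + y) ` S \<subseteq> A \<and> (\<lambda>a. a * y) ` P \<subseteq> A)"
  have "\<exists>f. \<forall>n::nat. good (f n) \<and> (\<exists>H y. step H y (f n) (f (Suc n)))"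
  proof (rule dependent_nat_choice)
    have "good ({0}, {1}, 1)"
      using A[of 1] by (simp add: good_def)
    then show "\<exists>\<sigma>. good \<sigma>" by blast
  next
    fix \<sigma> and n :: nat assume "good \<sigma>"
    then obtain S P m where \<sigma>: "\<sigma> = (S, P, m)" and fin: "finite S" "finite P"
      and S: "0 \<in> S" "\<And>s. s \<in> S \<Longrightarrow> eventually (\<lambda>y. s + y \<in> A) e"
      and P: "1 \<in> P" "0 \<notin> P" and m: "m \<ge> 1"
      by (cases \<sigma>) (auto simp: good_def)
    have "eventually (\<lambda>y. \<forall>s\<in>S. s + y \<in> A \<and> eventually (\<lambda>z. s + y + z \<in> A) e) e"
      by (intro eventually_ball_finite fin ballI eventually_idempotent_translate e S)
    moreover have "eventually (\<lambda>y. \<forall>a\<in>P. a * y \<in> A) e"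
      using P by (intro eventually_ball_finite fin ballI A) auto
    ultimately have "eventually (\<lambda>y. y \<in> FS x m \<and> y \<noteq> 0 \<and> (\<forall>a\<in>P. a * y \<in> A) \<and>
        (\<forall>s\<in>S. s + y \<in> A \<and> eventually (\<lambda>z. s + y + z \<in> A) e)) e"
      using FS[OF m] nz by (simp add: eventually_conj_iff)
    then obtain y where y: "y \<in> FS x m" "y \<noteq> 0" "\<And>a. a \<in> P \<Longrightarrow> a * y \<in> A"
      "\<And>s. s \<in> S \<Longrightarrow> s + y \<in> A" "\<And>s. s \<in> S \<Longrightarrow> eventually (\<lambda>z. s + y + z \<in> A) e"
      using eventually_happens'[OF e(1)] by blast
    obtain H where H: "finite H" "H \<noteq> {}" "H \<subseteq> {m..}" "y = (\<Sum>t\<in>H. x t)"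
      using y(1) by (auto simp: FS_def)
    \<comment> \<open>The new bound exceeds \<open>Max H\<close>, so the next index set starts after
      \<open>H\<close>.\<close>
    let ?\<sigma> = "(S \<union> (\<lambda>s. s + y) ` S, P \<union> (\<lambda>a. a * y) ` P, max m (Suc (Max H)))"
    have "good ?\<sigma>"
      using fin S P m y by (auto simp: good_def)
    moreover have "H \<subseteq> {m..<max m (Suc (Max H))}"
      using H by (auto simp: less_max_iff_disj less_Suc_eq_le)
    then have "step H y \<sigma> ?\<sigma>"
      using H y by (auto simp: step_def \<sigma>)
    ultimately show "\<exists>\<sigma>'. good \<sigma>' \<and> (\<exists>H y. step H y \<sigma> \<sigma>')"
      by blast
  qed
  then obtain f where good: "\<And>n::nat. good (f n)" and "\<forall>n. \<exists>H y. step H y (f n) (f (Suc n))"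
    by blast
  then obtain H y where step: "\<And>n. step (H n) (y n) (f n) (f (Suc n))"
    by metis
  define S P m where "S = (\<lambda>n. fst (f n))" and "P = (\<lambda>n. fst (snd (f n)))"
    and "m = (\<lambda>n. snd (snd (f n)))"
  have S: "0 \<in> S n" "S (Suc n) = S n \<union> (\<lambda>s. s + y n) ` S n" "(\<lambda>s. s + y n) ` S n \<subseteq> A"
    and P: "1 \<in> P n" "P (Suc n) = P n \<union> (\<lambda>a. a * y n) ` P n" "(\<lambda>a. a * y n) ` P n \<subseteq> A"
    and H: "finite (H n)" "H n \<noteq> {}" "H n \<subseteq> {m n..<m (Suc n)}" "y n = (\<Sum>t\<in>H n. x t)"
    and m: "m n \<ge> 1" for n
    using good[of n] step[of n]
    unfolding S_def P_def m_def good_def step_def case_prod_unfold by - blast+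
  have split: "sum y F = sum y (F - {k}) + y k" "prod y F = prod y (F - {k}) * y k"
    if "finite F" "k \<in> F" for F k
    using that by (simp_all add: sum.remove prod.remove ac_simps)
  have mem: "sum y F \<in> S n \<and> prod y F \<in> P n" if "F \<subseteq> {..<n}" for F n
    using that
  proof (induction n arbitrary: F)
    case 0
    then show ?case using S(1) P(1) by simp
  next
    case (Suc n)
    have "F - {n} \<subseteq> {..<n}" using Suc.prems by auto
    then have IH: "sum y (F - {n}) \<in> S n \<and> prod y (F - {n}) \<in> P n" by (rule Suc.IH)
    show ?case
    proof (cases "n \<in> F")
      case True
      then show ?thesis
        using IH split[of F n] finite_subset[OF Suc.prems] unfolding S(2) P(2) by auto
    next
      case False
      then show ?thesis using IH unfolding S(2) P(2) by simp
    qed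
  qed
  \<comment> \<open>The last term is split off: the rest, possibly the empty sum 0 or product 1, was
    available when that term was chosen.\<close>
  have in_A: "sum y F \<in> A \<and> prod y F \<in> A" if F: "finite F" "F \<noteq> {}" for F
  proof -
    have "F - {Max F} \<subseteq> {..<Max F}"
      using F by (auto simp: order.strict_iff_order)
    then show ?thesis
      using mem[of "F - {Max F}" "Max F"] split[OF F(1) Max_in[OF F]] S(3)[of "Max F"]
        P(3)[of "Max F"] by auto
  qed
  have "Max (H n) < Min (H (Suc n))" for n
    using H(1,2,3)[of n] H(1,2,3)[of "Suc n"] Max_in[of "H n"] Min_in[of "H (Suc n)"]
    by (meson atLeastLessThan_iff order_less_le_trans subsetD)
  moreover have "H n \<subseteq> {1..}" for n
    using H(3)[of n] m[of n] by auto
  ultimately have "sum_subsystem y x"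
    unfolding sum_subsystem_def by (intro exI[of _ H] allI impI conjI H)
  moreover have "FS y 1 \<union> FP y 1 \<subseteq> A"
    using in_A by (auto simp: FS_def FP_def)
  ultimately show ?thesis by blast
qed

text \<open>The hypotheses are what \<open>smallest_ideal\<close> and \<open>J_ultrafilters\<close>
  share. Scaling is additive, so it sends the idempotent \<open>e\<close> to an idempotent of
  \<open>I\<close>, which contains \<open>A\<close>.\<close>

lemma sum_subsystem_in_left_ideal:
  fixes x :: "nat \<Rightarrow> 'a::idom"
  assumes "(\<Inter>m\<in>{1..}. beta_closure (FS x m)) \<inter> I \<noteq> {}"
    and left: "\<And>r q. r \<in> ultrafilters \<Longrightarrow> q \<in> I \<Longrightarrow> r \<oplus> q \<in> I"
    and scale: "\<And>a q. a \<noteq> 0 \<Longrightarrow> q \<in> I \<Longrightarrow> filtermap ((*) a) q \<in> I"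
    and nz: "\<And>q. q \<in> I \<Longrightarrow> \<not> eventually (\<lambda>z. z = 0) q"
    and A: "\<And>q. q \<in> I \<Longrightarrow> q \<oplus> q = q \<Longrightarrow> eventually (\<lambda>z. z \<in> A) q"
  shows "\<exists>y. sum_subsystem y x \<and> FS y 1 \<union> FP y 1 \<subseteq> A"
proof -
  obtain e where e: "e \<in> ultrafilters" "e \<oplus> e = e" "e \<in> I"
    "\<And>m. m \<ge> 1 \<Longrightarrow> eventually (\<lambda>z. z \<in> FS x m) e"
    using FS_idempotent_in_left_ideal[OF assms(1) left] by metis
  have "eventually (\<lambda>z. a * z \<in> A) e" if "a \<noteq> 0" for a
    using A[OF scale[OF that e(3)]] filtermap_times_filter_add[of a e e] e(2)
    by (simp add: eventually_filtermap)
  moreover have "eventually (\<lambda>z. z \<noteq> 0) e"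
    using nz[OF e(3)] by (simp add: ultrafilter_not_iff[OF e(1)])
  ultimately show ?thesis
    using e by (intro sum_subsystem_FS_FP ultrafilter_neq_bot) auto
qed


section \<open>Residues of Gaussian integers\<close>

text \<open>Provides both the infinitude of the Gaussian integers and the fact that singletons are
  not \<open>J\<close>-sets.\<close>

instance gauss_int :: ring_char_0
proof
  have "Rep_gauss_int (of_nat n) = of_nat n" for n
    by (induction n) (simp_all add: zero_gauss_int.rep_eq one_gauss_int.rep_eq plus_gauss_int.rep_eq)
  then show "inj (of_nat :: nat \<Rightarrow> gauss_int)"
    by (intro injI) (metis of_nat_eq_iff)
qed

text \<open>The norm \<open>k\<close> is the product of \<open>a\<close> and its conjugate, so
  coordinates congruent modulo \<open>k\<close> give a difference divisible by \<open>a\<close>. The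
  floors read off the integer coordinates.\<close>

lemma gauss_int_norm_dvd:
  fixes a z w :: gauss_int
  defines "k \<equiv> \<lfloor>(cmod (Rep_gauss_int a))\<^sup>2\<rfloor>"
  assumes "\<lfloor>Re (Rep_gauss_int z)\<rfloor> mod k = \<lfloor>Re (Rep_gauss_int w)\<rfloor> mod k"
    and "\<lfloor>Im (Rep_gauss_int z)\<rfloor> mod k = \<lfloor>Im (Rep_gauss_int w)\<rfloor> mod k"
  shows "a dvd z - w"
proof -
  have "k dvd \<lfloor>Re (Rep_gauss_int z)\<rfloor> - \<lfloor>Re (Rep_gauss_int w)\<rfloor>"
    "k dvd \<lfloor>Im (Rep_gauss_int z)\<rfloor> - \<lfloor>Im (Rep_gauss_int w)\<rfloor>"
    using assms(2,3) by (simp_all add: mod_eq_dvd_iff)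
  then obtain r s where r: "\<lfloor>Re (Rep_gauss_int z)\<rfloor> - \<lfloor>Re (Rep_gauss_int w)\<rfloor> = k * r"
    and s: "\<lfloor>Im (Rep_gauss_int z)\<rfloor> - \<lfloor>Im (Rep_gauss_int w)\<rfloor> = k * s"
    unfolding dvd_def by blast
  have int: "Re (Rep_gauss_int u) \<in> \<int>" "Im (Rep_gauss_int u) \<in> \<int>" for u
    using Rep_gauss_int[of u] by auto
  then have fl: "of_int \<lfloor>Re (Rep_gauss_int u)\<rfloor> = Re (Rep_gauss_int u)"
    "of_int \<lfloor>Im (Rep_gauss_int u)\<rfloor> = Im (Rep_gauss_int u)" for u
    by simp_all
  have k: "of_int k = (cmod (Rep_gauss_int a))\<^sup>2"
    unfolding k_def using int[of a] by (simp add: cmod_power2)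
  let ?c = "cnj (Rep_gauss_int a) * Complex (of_int r) (of_int s)"
  have "Rep_gauss_int z - Rep_gauss_int w = of_int k * Complex (of_int r) (of_int s)"
    using arg_cong[OF r, of real_of_int] arg_cong[OF s, of real_of_int]
    unfolding of_int_diff of_int_mult fl by (simp add: complex_eq_iff)
  also have "\<dots> = Rep_gauss_int a * ?c"
  proof -
    have "(of_int k :: complex) = Rep_gauss_int a * cnj (Rep_gauss_int a)"
      using arg_cong[OF k, of complex_of_real] by (simp flip: complex_norm_square)
    then show ?thesis by (simp add: mult.assoc)
  qed
  also have "?c = Rep_gauss_int (Abs_gauss_int ?c)"
    using int[of a] by (intro Abs_gauss_int_inverse[symmetric]) auto
  finally have "z - w = a * Abs_gauss_int ?c"
    by (simp flip: Rep_gauss_int_inject add: minus_gauss_int.rep_eq times_gauss_int.rep_eq)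
  then show ?thesis by simp
qed

lemma finite_range_residue_gauss_int:
  fixes a :: gauss_int
  assumes "a \<noteq> 0"
  shows "finite (range (residue a))"
proof -
  define k where "k = \<lfloor>(cmod (Rep_gauss_int a))\<^sup>2\<rfloor>"
  define c where "c z = (\<lfloor>Re (Rep_gauss_int z)\<rfloor> mod k, \<lfloor>Im (Rep_gauss_int z)\<rfloor> mod k)" for z
  have "Rep_gauss_int a \<noteq> 0"
    using assms by (simp flip: Rep_gauss_int_inject add: zero_gauss_int.rep_eq)
  moreover have "Re (Rep_gauss_int a) \<in> \<int>" "Im (Rep_gauss_int a) \<in> \<int>"
    using Rep_gauss_int[of a] by auto
  then have "of_int k = (cmod (Rep_gauss_int a))\<^sup>2"
    unfolding k_def by (simp add: cmod_power2)
  ultimately have "real_of_int k > 0" by simp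
  then have "range c \<subseteq> {0..<k} \<times> {0..<k}"
    by (auto simp: c_def)
  then have fin: "finite (range c)"
    by (rule finite_subset) simp
  have c: "residue a z = residue a w" if "c z = c w" for z w
    using that gauss_int_norm_dvd[of z a w] by (simp add: c_def k_def residue_eq_iff)
  \<comment> \<open>The residue class factors through \<open>c\<close>, with \<open>inv c\<close>
    choosing a representative for each pair of coordinates modulo \<open>k\<close>.\<close>
  have "residue a z = residue a (inv c (c z))" for z
    by (rule c) (simp add: f_inv_into_f)
  then have "range (residue a) \<subseteq> (\<lambda>v. residue a (inv c v)) ` range c"
    by auto
  then show ?thesis
    using fin by (metis finite_imageI finite_subset)
qed

theorem theorem2p20:
  "(\<forall>(x :: nat \<Rightarrow> gauss_int) (A :: gauss_int set).
      minimal_seq x \<and> central_star A \<longrightarrow>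
        (\<exists>y. sum_subsystem y x \<and> FS y 1 \<union> FP y 1 \<subseteq> A)) \<and>
   (\<forall>(x :: nat \<Rightarrow> gauss_int) (A :: gauss_int set).
      almost_minimal_seq x \<and> C_star A \<longrightarrow>
        (\<exists>y. sum_subsystem y x \<and> FS y 1 \<union> FP y 1 \<subseteq> A))"
proof (intro conjI allI impI; elim conjE)
  fix x :: "nat \<Rightarrow> gauss_int" and A :: "gauss_int set"
  assume "minimal_seq x" "central_star A"
  then show "\<exists>y. sum_subsystem y x \<and> FS y 1 \<union> FP y 1 \<subseteq> A"
    unfolding minimal_seq_def central_star_def
    by (intro sum_subsystem_in_left_ideal[where I = smallest_ideal])
      (simp_all add: smallest_ideal_left smallest_ideal_scale finite_range_residue_gauss_int
        smallest_ideal_nonprincipal infinite_UNIV_char_0)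
next
  fix x :: "nat \<Rightarrow> gauss_int" and A :: "gauss_int set"
  assume "almost_minimal_seq x" "C_star A"
  moreover have "\<not> eventually (\<lambda>z. z = 0) q" if "q \<in> J_ultrafilters" for q :: "gauss_int filter"
  proof
    assume "eventually (\<lambda>z. z = 0) q"
    then have "J_set {0 :: gauss_int}"
      using that by (simp add: J_ultrafilters_def)
    then show False
      using not_J_set_singleton by blast
  qed
  ultimately show "\<exists>y. sum_subsystem y x \<and> FS y 1 \<union> FP y 1 \<subseteq> A"
    unfolding almost_minimal_seq_def C_star_def
    by (intro sum_subsystem_in_left_ideal[where I = J_ultrafilters])
      (simp_all add: J_ultrafilters_left J_ultrafilters_scale finite_range_residue_gauss_int)
qed

end
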